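(* Let $X$ be a graphical isotropic minimal surface with height function $h(x,y)$. Then $h$ must be harmonic, and suppose it admits a power series representation of the form $h(x,y)=\sum_{n=0}^\infty(c_nz^n+\overline{c_n}\,\bar z^n)$, $z=x+iy$. If we apply a Bonnet rotation with angle $\theta$ and a López–Ros deformation with parameter $\lambda$, then the resulting isotropic minimal surface is also graphical, with height function $h_{\theta,\lambda}$. Moreover, $h_{\theta,\lambda}$ admits a decomposition into the following components: (1) a plane parallel to the $xy$-plane given by $\operatorname{Re}\left(\frac{c_0\cos\theta+ic_0\sin\theta}2\right)$; (2) a plane given by $\operatorname{Re}\left(\frac{c_1\cdot A_{\mathbb C}^{-1}(x,y)(\cos\theta+i\sin\theta)}2\right)=\operatorname{Re}\left(\frac{c_1\cdot A_{\mathbb C}^{-1}(x,y)\exp(i\theta)}2\right)$; (3) an infinite sum of dilated and rotated isotropic generalised Enneper surfaces $h_{\mathrm{dil.Enpr}(n)}$ $(n\ge2)$, with the height function scaled by $\cos\theta$; (4) an infinite sum of dilated and rotated conjugate surfaces associated to the isotropic generalised Enneper surfaces (which are themselves isotropic generalised Enneper surfaces), given by $h^*_{\mathrm{dil.Enpr}(n)}$ $(n\ge2)$, with the height function scaled by $\sin\theta$.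
   Context: Isotropic $3$-space is $\mathbb R^3$ with the degenerate metric $dx^2+dy^2$; a graph $(x,y,h(x,y))$ is an isotropic minimal surface if and only if $h$ is harmonic, and such a surface has Weierstrass data of the form $(1,G)$. The surface obtained by Bonnet rotation with angle $\theta\in(0,2\pi]$ and López–Ros deformation with parameter $\lambda\in(0,+\infty)$ is $$X_{\theta,\lambda}=\operatorname{Re}\int^w\begin{pmatrix}1\\-i\\2\lambda G\end{pmatrix}\frac{e^{i\theta}}\lambda\,dw,\qquad w=u+iv,$$ and its first two components form the invertible linear map $A_{\mathbb C}:\mathbb C\to\mathbb R^2$, $A_{\mathbb C}(w)=\frac1\lambda(u\cos\theta-v\sin\theta,\;v\cos\theta+u\sin\theta)$. For $n\ge2$, $\frac{c_nz^n+\overline{c_n}\bar z^n}2$ is the height function of an isotropic generalised Enneper surface (one with Weierstrass data of the form $(1,az^{n-1})$, $a\in\mathbb C$). The function $h_{\mathrm{dil.Enpr}(n)}(x,y)$ is this expression evaluated at $z=A_{\mathbb C}^{-1}(x,y)$, and $h^*_{\mathrm{dil.Enpr}(n)}(x,y)$ is the same expression evaluated at $z=\exp(\tfrac{i\pi}{2n})\cdot A_{\mathbb C}^{-1}(x,y)$, which gives the conjugate surface.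
   Formalization: The displayed components do not add up to the height function as written (h = 1, c_0 = 1/2, θ = 2π, λ = 1 gives 1/4); the formal decomposition takes the two planes (1), (2) with weight 4 and the two infinite sums (3), (4) with weight 2. *)

theory Defs
  imports "HOL-Analysis.Analysis"
begin

subsection \<open>Partial derivatives and harmonic functions\<close>

text \<open>The directions of interest are basis vectors; on complex arguments \<open>w = u + iv\<close>
  the basis vectors \<open>1\<close> and \<open>\<i>\<close> give the partial derivatives in \<open>u\<close> and \<open>v\<close>.\<close>

definition dir_deriv ::
  "'a::real_normed_vector \<Rightarrow> ('a \<Rightarrow> 'b::real_normed_vector) \<Rightarrow> 'a \<Rightarrow> 'b" where
  "dir_deriv d f p = vector_derivative (\<lambda>t. f (p + t *\<^sub>R d)) (at 0)"

definition C1_on :: "'a::euclidean_space set \<Rightarrow> ('a \<Rightarrow> 'b::real_normed_vector) \<Rightarrow> bool" where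
  "C1_on S f \<longleftrightarrow>
     (\<forall>d\<in>Basis. (\<forall>p\<in>S. (\<lambda>t::real. f (p + t *\<^sub>R d)) differentiable (at 0)) \<and>
                continuous_on S (dir_deriv d f))"

definition C2_on :: "'a::euclidean_space set \<Rightarrow> ('a \<Rightarrow> 'b::real_normed_vector) \<Rightarrow> bool" where
  "C2_on S f \<longleftrightarrow> C1_on S f \<and> (\<forall>d\<in>Basis. C1_on S (dir_deriv d f))"

definition harmonic_on :: "'a::euclidean_space set \<Rightarrow> ('a \<Rightarrow> real) \<Rightarrow> bool" where
  "harmonic_on S f \<longleftrightarrow>
     C2_on S f \<and> (\<forall>p\<in>S. (\<Sum>d\<in>Basis. dir_deriv d (dir_deriv d f) p) = 0)"

subsection \<open>Surfaces in isotropic 3-space\<close>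

text \<open>Isotropic 3-space is \<open>real^3\<close> with the degenerate metric \<open>dx\<^sup>2 + dy\<^sup>2\<close>.
  A parametrised surface is a map from a domain of the \<open>w\<close>-plane, \<open>w = u + iv\<close>.\<close>

definition iso_inner :: "real^3 \<Rightarrow> real^3 \<Rightarrow> real" where
  "iso_inner a b = a $ 1 * b $ 1 + a $ 2 * b $ 2"

text \<open>The discriminant \<open>EG - F\<^sup>2\<close> of the induced metric.\<close>

definition iso_disc :: "(complex \<Rightarrow> real^3) \<Rightarrow> complex \<Rightarrow> real" where
  "iso_disc X w =
     iso_inner (dir_deriv 1 X w) (dir_deriv 1 X w) * iso_inner (dir_deriv \<i> X w) (dir_deriv \<i> X w)
     - (iso_inner (dir_deriv 1 X w) (dir_deriv \<i> X w))\<^sup>2"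

text \<open>The coefficients of the isotropic second fundamental form are
  \<open>det (X\<^sub>u, X\<^sub>v, X\<^sub>i\<^sub>j) / sqrt (EG - F\<^sup>2)\<close>.\<close>

definition iso_second_form ::
  "(complex \<Rightarrow> real^3) \<Rightarrow> complex \<Rightarrow> complex \<Rightarrow> complex \<Rightarrow> real" where
  "iso_second_form X w d e =
     det (vector [dir_deriv 1 X w, dir_deriv \<i> X w, dir_deriv d (dir_deriv e X) w] :: real^3^3)
     / sqrt (iso_disc X w)"

definition iso_mean_curvature :: "(complex \<Rightarrow> real^3) \<Rightarrow> complex \<Rightarrow> real" where
  "iso_mean_curvature X w =
     (iso_inner (dir_deriv 1 X w) (dir_deriv 1 X w) * iso_second_form X w \<i> \<i>
      - 2 * iso_inner (dir_deriv 1 X w) (dir_deriv \<i> X w) * iso_second_form X w 1 \<i>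
      + iso_inner (dir_deriv \<i> X w) (dir_deriv \<i> X w) * iso_second_form X w 1 1)
     / (2 * iso_disc X w)"

text \<open>Minimal surfaces are spacelike immersions (the induced metric is nondegenerate) of
  vanishing mean curvature.\<close>

definition isotropic_minimal_surface :: "complex set \<Rightarrow> (complex \<Rightarrow> real^3) \<Rightarrow> bool" where
  "isotropic_minimal_surface U X \<longleftrightarrow>
     C2_on U X \<and> (\<forall>w\<in>U. iso_disc X w > 0) \<and> (\<forall>w\<in>U. iso_mean_curvature X w = 0)"

definition graph_over :: "(real \<times> real) set \<Rightarrow> (real \<times> real \<Rightarrow> real) \<Rightarrow> (real^3) set" where
  "graph_over \<Omega> h = {vector [x, y, h (x, y)] | x y. (x, y) \<in> \<Omega>}"

definition graph_param :: "(real \<times> real \<Rightarrow> real) \<Rightarrow> complex \<Rightarrow> real^3" where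
  "graph_param h w = vector [Re w, Im w, h (Re w, Im w)]"

definition param_domain :: "(real \<times> real) set \<Rightarrow> complex set" where
  "param_domain \<Omega> = {w. (Re w, Im w) \<in> \<Omega>}"

subsection \<open>Weierstrass data\<close>

text \<open>\<open>\<Phi>\<close> is a primitive of \<open>(1, -i, 2G) F dw\<close>.\<close>

definition weierstrass_primitive ::
  "complex set \<Rightarrow> (complex \<Rightarrow> complex) \<Rightarrow> (complex \<Rightarrow> complex) \<Rightarrow> (complex \<Rightarrow> complex^3) \<Rightarrow> bool" where
  "weierstrass_primitive U F G \<Phi> \<longleftrightarrow>
     F holomorphic_on U \<and> G holomorphic_on U \<and>
     (\<forall>w\<in>U. \<forall>j. ((\<lambda>w. \<Phi> w $ j) has_field_derivative
        (vector [F w, - \<i> * F w, 2 * G w * F w] :: complex^3) $ j) (at w))"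

definition Re_vec :: "complex^3 \<Rightarrow> real^3" where
  "Re_vec z = (\<chi> j. Re (z $ j))"

text \<open>\<open>X = Re \<integral> (1, -i, 2G) F dw\<close>, for some choice of the integration constants.\<close>

definition weierstrass_surface ::
  "complex set \<Rightarrow> (complex \<Rightarrow> complex) \<Rightarrow> (complex \<Rightarrow> complex) \<Rightarrow> (complex \<Rightarrow> real^3) \<Rightarrow> bool" where
  "weierstrass_surface U F G X \<longleftrightarrow>
     (\<exists>\<Phi>. weierstrass_primitive U F G \<Phi> \<and> (\<forall>w\<in>U. X w = Re_vec (\<Phi> w)))"

text \<open>The real part of \<open>\<integral> (1, -i, 2 l G) (exp (i \<theta>) / l) dw\<close>, where \<open>\<Phi>\<close> is the chosen
  primitive of \<open>(1, -i, 2G) dw\<close>. Fixing \<open>\<Phi>\<close> fixes the integration constants for all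
  \<open>\<theta>\<close> and \<open>l\<close> simultaneously.\<close>

definition bonnet_lopez_ros ::
  "real \<Rightarrow> real \<Rightarrow> (complex \<Rightarrow> complex^3) \<Rightarrow> complex \<Rightarrow> real^3" where
  "bonnet_lopez_ros \<theta> l \<Phi> w =
     Re_vec ((exp (\<i> * of_real \<theta>) / of_real l) *s
       vector [\<Phi> w $ 1, \<Phi> w $ 2, of_real l * \<Phi> w $ 3])"

text \<open>The conjugate surface is the Bonnet rotation by the angle \<open>\<pi>/2\<close>.\<close>

definition conjugate_surface ::
  "complex set \<Rightarrow> (complex \<Rightarrow> real^3) \<Rightarrow> (complex \<Rightarrow> real^3) \<Rightarrow> bool" where
  "conjugate_surface U X Y \<longleftrightarrow>
     (\<exists>F G \<Phi>. weierstrass_primitive U F G \<Phi> \<and>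
        (\<forall>w\<in>U. X w = Re_vec (\<Phi> w)) \<and> (\<forall>w\<in>U. Y w = Re_vec (\<i> *s \<Phi> w)))"

text \<open>Dilations and rotations act on the horizontal coordinates only.\<close>

definition dilated_rotated :: "(real^3) set \<Rightarrow> (real^3) set \<Rightarrow> bool" where
  "dilated_rotated S T \<longleftrightarrow>
     (\<exists>r>0. \<exists>\<alpha>. T = (\<lambda>p. vector [r * (p $ 1 * cos \<alpha> - p $ 2 * sin \<alpha>),
                                r * (p $ 1 * sin \<alpha> + p $ 2 * cos \<alpha>), p $ 3]) ` S)"

definition isotropic_generalised_Enneper :: "nat \<Rightarrow> (complex \<Rightarrow> real^3) \<Rightarrow> bool" where
  "isotropic_generalised_Enneper n X \<longleftrightarrow>
     (\<exists>a. weierstrass_surface UNIV (\<lambda>_. 1) (\<lambda>w. a * w ^ (n - 1)) X)"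

subsection \<open>The components of the deformed height function\<close>

definition A_C :: "real \<Rightarrow> real \<Rightarrow> complex \<Rightarrow> real \<times> real" where
  "A_C \<theta> l w = ((Re w * cos \<theta> - Im w * sin \<theta>) / l, (Im w * cos \<theta> + Re w * sin \<theta>) / l)"

lemma A_C_cis:
  "A_C \<theta> l w = (Re (cis \<theta> * w / of_real l), Im (cis \<theta> * w / of_real l))"
  by (simp add: A_C_def algebra_simps)

lemma inv_A_C:
  assumes "l \<noteq> 0"
  shows "bij (A_C \<theta> l)" and "inv (A_C \<theta> l) (x, y) = of_real l * cis (- \<theta>) * Complex x y"
proof -
  define B where "B = (\<lambda>(x, y). of_real l * cis (- \<theta>) * Complex x y)"
  have cis1: "cis (- \<theta>) * cis \<theta> = 1"
    by (simp add: cis_mult)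
  have "B (A_C \<theta> l w) = w" for w
  proof -
    have "B (A_C \<theta> l w) = of_real l * cis (- \<theta>) * (cis \<theta> * w / of_real l)"
      unfolding B_def A_C_cis prod.case complex_surj ..
    also have "\<dots> = cis (- \<theta>) * cis \<theta> * w"
      using assms by (simp add: field_simps del: cis_mult)
    finally show ?thesis
      by (simp add: cis1)
  qed
  moreover have "A_C \<theta> l (B p) = p" for p
  proof -
    obtain x y where p: "p = (x, y)" by (cases p)
    have "cis \<theta> * B p / of_real l = cis (- \<theta>) * cis \<theta> * Complex x y"
      unfolding B_def p prod.case using assms by (simp add: field_simps del: cis_mult)
    then show ?thesis
      by (simp add: A_C_cis cis1 p del: Re_divide_of_real Im_divide_of_real)
  qed
  ultimately show "bij (A_C \<theta> l)" and "inv (A_C \<theta> l) (x, y) = of_real l * cis (- \<theta>) * Complex x y"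
    using o_bij[of B "A_C \<theta> l"] inv_equality[of B "A_C \<theta> l"]
    by (auto simp: B_def fun_eq_iff)
qed

text \<open>Normalisation: for \<open>h = \<Sum> (c\<^sub>n z\<^sup>n + cnj (c\<^sub>n z\<^sup>n))\<close> the deformed height function is
  \<open>2 \<Sum> Re (exp (i\<theta>) c\<^sub>n z\<^sup>n)\<close> with \<open>z\<close> the preimage of \<open>(x, y)\<close> under \<open>A_C\<close>. The Enneper
  components below are \<open>Re (c\<^sub>n z\<^sup>n)\<close> and \<open>Re (i c\<^sub>n z\<^sup>n)\<close>, while the planes carry an extra
  factor \<open>1/2\<close>; so the components add up to the height function with weights \<open>4\<close>
  for the planes and \<open>2 cos \<theta>\<close>, \<open>2 sin \<theta>\<close> for the Enneper components.\<close>

text \<open>The outer \<open>Re\<close> only converts the type: the argument is a real number.\<close>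

definition h_Enpr :: "complex \<Rightarrow> nat \<Rightarrow> complex \<Rightarrow> real" where
  "h_Enpr a n z = Re ((a * z ^ n + cnj a * cnj z ^ n) / 2)"

definition h_dil_Enpr :: "(nat \<Rightarrow> complex) \<Rightarrow> real \<Rightarrow> real \<Rightarrow> nat \<Rightarrow> real \<times> real \<Rightarrow> real" where
  "h_dil_Enpr c \<theta> l n p = h_Enpr (c n) n (inv (A_C \<theta> l) p)"

definition h_conj_dil_Enpr :: "(nat \<Rightarrow> complex) \<Rightarrow> real \<Rightarrow> real \<Rightarrow> nat \<Rightarrow> real \<times> real \<Rightarrow> real" where
  "h_conj_dil_Enpr c \<theta> l n p =
     h_Enpr (c n) n (exp (\<i> * of_real pi / (2 * of_nat n)) * inv (A_C \<theta> l) p)"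

definition plane0 :: "(nat \<Rightarrow> complex) \<Rightarrow> real \<Rightarrow> real \<times> real \<Rightarrow> real" where
  "plane0 c \<theta> p = Re ((c 0 * of_real (cos \<theta>) + \<i> * c 0 * of_real (sin \<theta>)) / 2)"

definition plane1 :: "(nat \<Rightarrow> complex) \<Rightarrow> real \<Rightarrow> real \<Rightarrow> real \<times> real \<Rightarrow> real" where
  "plane1 c \<theta> l p =
     Re (c 1 * inv (A_C \<theta> l) p * (of_real (cos \<theta>) + \<i> * of_real (sin \<theta>)) / 2)"

definition is_plane :: "(real^3) set \<Rightarrow> bool" where
  "is_plane S \<longleftrightarrow> affine S \<and> aff_dim S = 2"

end

theory Submission
  imports Defs "HOL-Complex_Analysis.Cauchy_Integral_Formula"
begin

text \<open>
  For a graph the induced metric is Euclidean and the mean curvature is half the Laplacian of the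
  height, so minimality gives harmonicity. The expansion of \<open>h\<close> is assumed to converge only
  pointwise and only in its real part; a Baire category argument on an arc of a circle shows that
  \<open>\<Sum> 2 c\<^sub>n w\<^sup>n\<close> nevertheless converges beyond every point of the domain, to a holomorphic
  \<open>f\<close> with \<open>h = Re f\<close>. Then \<open>(w, -iw, f w)\<close> is a primitive of the Weierstrass data
  \<open>(1, f'/2)\<close>, the deformed surface is the graph of \<open>Re (exp (i\<theta>) f)\<close> over the image of
  \<open>A_C\<close>, and \<open>Re (exp (i\<theta>) u) = cos \<theta> Re u + sin \<theta> Re (iu)\<close>, applied to each term, splits the
  height into the Enneper surfaces and their conjugates, since \<open>exp (i\<pi>/(2n))\<^sup>n = i\<close>.
\<close>

subsection \<open>Convergence of power series from their real parts\<close>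

text \<open>Over \<open>{a..b}\<close> the argument of \<open>z * cis (n * t)\<close> grows by at
  least \<open>pi\<close>, so it meets a multiple of \<open>pi\<close>, where the number is
  real.\<close>

lemma exists_phase_on_interval:
  fixes z :: complex and a b :: real
  assumes "a < b" and n: "real n * (b - a) \<ge> pi"
  shows "\<exists>t\<in>{a..b}. \<bar>Re (z * cis (real n * t))\<bar> = norm z"
proof -
  define \<alpha> where "\<alpha> = Arg z"
  \<comment> \<open>The least multiple of \<open>pi\<close> not below the argument at
    \<open>t = a\<close>; it is reached at time \<open>t\<close>, at most \<open>pi / n\<close>
    after \<open>a\<close>.\<close>
  define k where "k = \<lceil>(\<alpha> + n * a) / pi\<rceil>"
  define t where "t = (k * pi - \<alpha>) / n"
  have n0: "real n > 0"
    using n pi_gt_zero \<open>a < b\<close> by (metis less_le_not_le mult_zero_left of_nat_0 of_nat_0_le_iff order_le_less)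
  have "of_int k \<ge> (\<alpha> + n * a) / pi" "of_int k < (\<alpha> + n * a) / pi + 1"
    unfolding k_def by linarith+
  then have 1: "k * pi \<ge> \<alpha> + n * a" and 2: "k * pi < \<alpha> + n * a + pi"
    by (simp_all add: field_simps)
  have "t \<ge> a" using 1 n0 by (simp add: t_def field_simps)
  moreover have "t \<le> b" using 2 n n0 by (simp add: t_def field_simps)
  moreover have "Re (z * cis (real n * t)) = norm z * cos (k * pi)"
  proof -
    have "z * cis (n * t) = of_real (norm z) * (cis \<alpha> * cis (n * t))"
      by (metis \<alpha>_def mult.assoc rcis_cmod_Arg rcis_def)
    also have "cis \<alpha> * cis (n * t) = cis (k * pi)"
      using n0 by (simp add: cis_mult t_def)
    finally show ?thesis by simp
  qed
  moreover have "\<bar>cos (of_int k * pi)\<bar> = 1"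
    by (simp add: mult.commute)
  ultimately show ?thesis
    by (intro bexI[of _ t]) (auto simp: abs_mult)
qed

text \<open>By Baire's theorem the terms are uniformly at most 1 on some subinterval for all large \<open>n\<close>; there
  the phase \<open>nt\<close> runs through at least half a turn, so that the full modulus is attained.\<close>

lemma bounded_coeffs_if_Re_tendsto_0:
  fixes d :: "nat \<Rightarrow> complex"
  assumes "\<delta> > 0" and lim: "\<And>t. t \<in> {-\<delta>..\<delta>} \<Longrightarrow> (\<lambda>n. Re (d n * cis (real n * t))) \<longlonglongrightarrow> 0"
  shows "\<forall>\<^sub>F n in sequentially. norm (d n) \<le> 1"
proof -
  define S where "S = {-\<delta>..\<delta>}"
  define E where "E = (\<lambda>N. {t\<in>S. \<forall>n\<ge>N. \<bar>Re (d n * cis (real n * t))\<bar> \<le> 1})"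
  have cl: "closed (E N)" for N
  proof -
    have "E N = S \<inter> (\<Inter>n\<in>{N..}. {t. \<bar>Re (d n * cis (real n * t))\<bar> \<le> 1})"
      by (auto simp: E_def)
    moreover have "closed {t. \<bar>Re (d n * cis (real n * t))\<bar> \<le> 1}" for n
      by (intro closed_Collect_le continuous_intros)
    ultimately show ?thesis
      unfolding S_def by (simp only:) (intro closed_Int closed_INT closed_real_atLeastAtMost ballI)
  qed
  have "S \<subseteq> (\<Union>N. E N)"
  proof
    fix t assume t: "t \<in> S"
    have "\<forall>\<^sub>F n in sequentially. norm (Re (d n * cis (real n * t)) - 0) < 1"
      using lim[of t] t tendstoD[of _ 0 sequentially 1] unfolding S_def dist_norm by force
    then obtain N where "\<And>n. n \<ge> N \<Longrightarrow> \<bar>Re (d n * cis (real n * t))\<bar> < 1"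
      by (auto simp: eventually_sequentially)
    then have "t \<in> E N" using t by (auto simp: E_def intro: less_imp_le)
    then show "t \<in> (\<Union>N. E N)" by blast
  qed
  then have inter: "(\<Inter>N. S - E N) = {}" by blast
  \<comment> \<open>The sets \<open>S - E N\<close> are relatively open with empty intersection, so
    by Baire they cannot all be dense in the nonempty closed set \<open>S\<close>.\<close>
  have "\<exists>N. \<not> S \<subseteq> closure (S - E N)"
  proof (rule ccontr)
    assume "\<not> ?thesis"
    then have dense: "S \<subseteq> closure (S - E N)" for N by blast
    have "openin (top_of_set S) (S - E N)" for N
      using cl[of N] by (metis Diff_eq open_Compl openin_open_Int)
    then have "S \<subseteq> closure (\<Inter>(range (\<lambda>N. S - E N)))"
      using dense by (intro Baire) (auto simp: S_def)
    with inter have "S = {}" by (metis closure_empty subset_empty)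
    then show False using \<open>\<delta> > 0\<close> by (auto simp: S_def)
  qed
  then obtain N x where x: "x \<in> S" "x \<notin> closure (S - E N)" by blast
  then obtain r where r: "r > 0" "\<And>y. y \<in> S \<Longrightarrow> \<bar>y - x\<bar> < r \<Longrightarrow> y \<in> E N"
    unfolding closure_approachable dist_real_def by blast
  \<comment> \<open>A closed interval around \<open>x\<close> of half the radius, clipped to
    \<open>S\<close> so that it lies in \<open>E N\<close>. It is nondegenerate even if
    \<open>x\<close> is an endpoint of \<open>S\<close>.\<close>
  define a where "a = max (-\<delta>) (x - r/2)"
  define b where "b = min \<delta> (x + r/2)"
  have "a < b" using x r \<open>\<delta> > 0\<close> by (auto simp: a_def b_def S_def)
  have sub: "t \<in> E N" if "t \<in> {a..b}" for t
    using that x r(1) by (intro r(2)) (auto simp: a_def b_def S_def)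
  \<comment> \<open>From \<open>M\<close> on, the phase \<open>n * t\<close> sweeps an angle of at
    least \<open>pi\<close> over \<open>{a..b}\<close>.\<close>
  obtain M where M: "real M * (b - a) \<ge> pi"
    using real_arch_simple[of "pi / (b - a)"] \<open>a < b\<close> by (auto simp: field_simps)
  have "norm (d n) \<le> 1" if "n \<ge> max N M" for n
  proof -
    have "real n * (b - a) \<ge> pi"
      using M that \<open>a < b\<close> by (smt (verit) max.boundedE mult_right_mono of_nat_le_iff)
    then obtain t where "t \<in> {a..b}" "\<bar>Re (d n * cis (real n * t))\<bar> = norm (d n)"
      using exists_phase_on_interval[OF \<open>a < b\<close>] by blast
    then show ?thesis using sub that by (force simp: E_def)
  qed
  then show ?thesis unfolding eventually_sequentially by blast
qed

text \<open>An open set around \<open>w \<noteq> 0\<close> contains an arc of a circle of slightly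
  larger radius. Vanishing real parts along that arc bound the full terms there, and a geometric
  comparison gives convergence at a point between the two radii.\<close>

lemma power_series_converges_beyond_if_Re_tendsto_0:
  fixes c :: "nat \<Rightarrow> complex"
  assumes "open U" and lim: "\<And>z. z \<in> U \<Longrightarrow> (\<lambda>n. Re (c n * z ^ n)) \<longlonglongrightarrow> 0"
    and "w \<in> U"
  shows "\<exists>K. norm w < norm K \<and> summable (\<lambda>n. c n * K ^ n)"
proof -
  have *: "\<exists>K. norm w < norm K \<and> summable (\<lambda>n. c n * K ^ n)" if "w \<in> U" "w \<noteq> 0" for w
  proof -
    \<comment> \<open>Polar coordinates relative to \<open>w\<close>, which is the image of
      \<open>(1, 0)\<close>. A product neighbourhood of \<open>(1, 0)\<close> supplies a radius and
      an arc.\<close>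
    define g where "g = (\<lambda>(s::real, t). of_real s * cis t * w)"
    have "open (g -` U)"
      unfolding g_def case_prod_unfold
      by (rule open_vimage[OF \<open>open U\<close>]) (intro continuous_intros)
    moreover have "(1, 0) \<in> g -` U" using \<open>w \<in> U\<close> by (simp add: g_def)
    ultimately obtain A B where AB: "open A" "open B" "(1, 0) \<in> A \<times> B" "A \<times> B \<subseteq> g -` U"
      by (rule open_prod_elim)
    obtain e where e: "e > 0" "cball 1 e \<subseteq> A" using AB open_contains_cball by blast
    obtain \<delta> where \<delta>: "\<delta> > 0" "cball 0 \<delta> \<subseteq> B" using AB open_contains_cball by blast
    define q where "q = 1 + e"
    have q: "q > 1" "q \<in> A" using e by (auto simp: q_def dist_real_def)
    \<comment> \<open>On the arc of radius \<open>q * norm w\<close> the terms of the series are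
      \<open>d n * cis (n * t)\<close> with \<open>d n = c n * (q * w) ^ n\<close>.\<close>
    have "\<forall>\<^sub>F n in sequentially. norm (c n * (of_real q * w) ^ n) \<le> 1"
    proof (rule bounded_coeffs_if_Re_tendsto_0[OF \<delta>(1)])
      fix t assume "t \<in> {-\<delta>..\<delta>}"
      then have "t \<in> B" using \<delta> by (auto simp: dist_real_def)
      then have "g (q, t) \<in> U" using AB q by blast
      moreover have "c n * (of_real q * w) ^ n * cis (real n * t) = c n * g (q, t) ^ n" for n
        by (simp add: g_def power_mult_distrib mult_ac Complex.DeMoivre)
      ultimately show "(\<lambda>n. Re (c n * (of_real q * w) ^ n * cis (real n * t))) \<longlonglongrightarrow> 0"
        using lim by (simp only:)
    qed
    moreover define s where "s = (1 + q) / 2"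
    have s: "1 < s" "s < q" using q by (auto simp: s_def)
    ultimately have "\<forall>\<^sub>F n in sequentially. norm (c n * (of_real s * w) ^ n) \<le> (s / q) ^ n"
    proof (elim eventually_mono)
      fix n assume "norm (c n * (of_real q * w) ^ n) \<le> 1"
      then have "norm (c n * (of_real q * w) ^ n) * (s / q) ^ n \<le> 1 * (s / q) ^ n"
        using s by (intro mult_right_mono) auto
      then show "norm (c n * (of_real s * w) ^ n) \<le> (s / q) ^ n"
        using s by (simp add: norm_mult norm_power power_mult_distrib power_divide mult_ac)
    qed
    moreover have "summable (\<lambda>n. (s / q) ^ n)" using s by (intro summable_geometric) auto
    ultimately have "summable (\<lambda>n. c n * (of_real s * w) ^ n)"
      by (rule summable_comparison_test_ev)
    moreover have "norm w < norm (of_real s * w)" using s \<open>w \<noteq> 0\<close> by (simp add: norm_mult)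
    ultimately show ?thesis by blast
  qed
  show ?thesis
  proof (cases "w = 0")
    case True
    \<comment> \<open>Scaling does not move the origin, so the result is taken at a nearby nonzero
      point; its \<open>K\<close> has positive norm.\<close>
    obtain e where e: "e > 0" "ball 0 e \<subseteq> U"
      using \<open>open U\<close> \<open>w \<in> U\<close> True by (auto simp: open_contains_ball)
    then have "of_real (e / 2) \<in> U" "of_real (e / 2) \<noteq> (0 :: complex)"
      by (auto simp: subset_iff)
    from *[OF this] show ?thesis by (metis True le_less_trans norm_ge_zero norm_zero)
  qed (use * \<open>w \<in> U\<close> in blast)
qed

subsection \<open>Minimal graphs have harmonic height\<close>

lemma dir_deriv_eqI:
  "((\<lambda>t. f (p + t *\<^sub>R d)) has_vector_derivative D) (at 0) \<Longrightarrow> dir_deriv d f p = D"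
  unfolding dir_deriv_def by (rule vector_derivative_at)

lemma dir_deriv_works:
  "C1_on S f \<Longrightarrow> d \<in> Basis \<Longrightarrow> p \<in> S \<Longrightarrow>
     ((\<lambda>t. f (p + t *\<^sub>R d)) has_vector_derivative dir_deriv d f p) (at 0)"
  unfolding C1_on_def dir_deriv_def by (auto simp: vector_derivative_works)

text \<open>For small \<open>t\<close> the line stays in the open set \<open>S\<close>, so agreement
  of the functions on \<open>S\<close> suffices.\<close>

lemma has_vector_derivative_along_line_cong:
  fixes p d :: "'a::real_normed_vector"
  assumes "((\<lambda>t. f (p + t *\<^sub>R d)) has_vector_derivative D) (at 0)"
    and "open S" "p \<in> S" "\<And>q. q \<in> S \<Longrightarrow> f q = g q"
  shows "((\<lambda>t. g (p + t *\<^sub>R d)) has_vector_derivative D) (at 0)"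
proof (rule has_vector_derivative_transform_within_open[OF assms(1)])
  show "open ((\<lambda>t. p + t *\<^sub>R d) -` S)"
    by (rule open_vimage[OF \<open>open S\<close>]) (intro continuous_intros)
qed (use assms in auto)

lemma C1_onI:
  assumes "\<And>d p. d \<in> Basis \<Longrightarrow> p \<in> S \<Longrightarrow>
      ((\<lambda>t. f (p + t *\<^sub>R d)) has_vector_derivative D d p) (at 0)"
    and "\<And>d. d \<in> Basis \<Longrightarrow> continuous_on S (D d)"
  shows "C1_on S f"
proof -
  have "continuous_on S (dir_deriv d f)" if "d \<in> Basis" for d
    using assms(2)[OF that] dir_deriv_eqI[OF assms(1)[OF that]] by (simp cong: continuous_on_cong)
  then show ?thesis
    using assms(1) unfolding C1_on_def by (blast intro: differentiableI_vector)
qed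

text \<open>A linear \<open>\<phi>\<close> carries the line through \<open>p\<close> in direction
  \<open>d\<close> to the line through \<open>\<phi> p\<close> in direction \<open>\<phi> d\<close>.
  The image direction must be a basis vector because \<open>C1_on\<close> controls only
  those.\<close>

lemma dir_deriv_linear_change:
  fixes \<phi> :: "'a::euclidean_space \<Rightarrow> 'b::euclidean_space"
  assumes "C1_on U X" "open S" "bounded_linear L" "linear \<phi>" "\<phi> ` S \<subseteq> U"
    and f: "\<And>q. q \<in> S \<Longrightarrow> f q = L (X (\<phi> q))"
    and "\<phi> d \<in> Basis" "p \<in> S"
  shows "((\<lambda>t. f (p + t *\<^sub>R d)) has_vector_derivative L (dir_deriv (\<phi> d) X (\<phi> p))) (at 0)"
proof (rule has_vector_derivative_along_line_cong[of "\<lambda>q. L (X (\<phi> q))", OF _ \<open>open S\<close> \<open>p \<in> S\<close>])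
  have "((\<lambda>t. X (\<phi> p + t *\<^sub>R \<phi> d)) has_vector_derivative dir_deriv (\<phi> d) X (\<phi> p)) (at 0)"
    using \<open>\<phi> ` S \<subseteq> U\<close> \<open>p \<in> S\<close> by (intro dir_deriv_works[OF \<open>C1_on U X\<close> \<open>\<phi> d \<in> Basis\<close>]) auto
  then show "((\<lambda>t. L (X (\<phi> (p + t *\<^sub>R d)))) has_vector_derivative
      L (dir_deriv (\<phi> d) X (\<phi> p))) (at 0)"
    using bounded_linear.has_vector_derivative[OF \<open>bounded_linear L\<close>]
    by (simp add: linear_add[OF \<open>linear \<phi>\<close>] linear_scale[OF \<open>linear \<phi>\<close>])
qed (simp add: f)

lemma C1_on_linear_change:
  fixes \<phi> :: "'a::euclidean_space \<Rightarrow> 'b::euclidean_space"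
  assumes "C1_on U X" "open S" "bounded_linear L" "linear \<phi>" "\<phi> ` S \<subseteq> U"
    and "\<And>q. q \<in> S \<Longrightarrow> f q = L (X (\<phi> q))"
    and B: "\<phi> ` Basis \<subseteq> Basis"
  shows "C1_on S f"
proof (rule C1_onI)
  show "((\<lambda>t. f (p + t *\<^sub>R d)) has_vector_derivative L (dir_deriv (\<phi> d) X (\<phi> p))) (at 0)"
    if "d \<in> Basis" "p \<in> S" for d p
    using B that by (intro dir_deriv_linear_change[OF assms(1-6)]) blast+
  show "continuous_on S (\<lambda>p. L (dir_deriv (\<phi> d) X (\<phi> p)))" if "d \<in> Basis" for d
  proof (intro bounded_linear.continuous_on[OF \<open>bounded_linear L\<close>])
    have "continuous_on U (dir_deriv (\<phi> d) X)"
      using \<open>C1_on U X\<close> B that unfolding C1_on_def by blast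
    then show "continuous_on S (\<lambda>p. dir_deriv (\<phi> d) X (\<phi> p))"
      using \<open>\<phi> ` S \<subseteq> U\<close> linear_continuous_on[of \<phi> S] \<open>linear \<phi>\<close>
      unfolding linear_conv_bounded_linear by (blast intro: continuous_on_compose2[of U _ S \<phi>])
  qed
qed

text \<open>On \<open>S\<close> the first derivatives of \<open>f\<close> again have the form
  \<open>L\<close> after a derivative of \<open>X\<close> after \<open>\<phi>\<close>, so the
  first-order statements apply a second time.\<close>

lemma C2_on_linear_change:
  fixes \<phi> :: "'a::euclidean_space \<Rightarrow> 'b::euclidean_space"
  assumes "C2_on U X" "open S" "bounded_linear L" "linear \<phi>" "\<phi> ` S \<subseteq> U"
    and "\<And>q. q \<in> S \<Longrightarrow> f q = L (X (\<phi> q))"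
    and B: "\<phi> ` Basis \<subseteq> Basis"
  shows "C2_on S f"
    and "\<And>d e p. d \<in> Basis \<Longrightarrow> e \<in> Basis \<Longrightarrow> p \<in> S \<Longrightarrow>
      dir_deriv d (dir_deriv e f) p = L (dir_deriv (\<phi> d) (dir_deriv (\<phi> e) X) (\<phi> p))"
proof -
  have C1: "C1_on U X" and C1': "\<And>e. e \<in> Basis \<Longrightarrow> C1_on U (dir_deriv (\<phi> e) X)"
    using assms(1) B unfolding C2_on_def by blast+
  have 1: "dir_deriv e f q = L (dir_deriv (\<phi> e) X (\<phi> q))" if "e \<in> Basis" "q \<in> S" for e q
    using B that by (intro dir_deriv_eqI[OF dir_deriv_linear_change[OF C1 assms(2-6)]]) blast+
  show "C2_on S f"
    unfolding C2_on_def
  proof safe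
    show "C1_on S f" by (rule C1_on_linear_change[OF C1 assms(2-7)])
    show "C1_on S (dir_deriv e f)" if "e \<in> Basis" for e
      by (rule C1_on_linear_change[OF C1'[OF that] assms(2-5) 1[OF that] B])
  qed
  show "dir_deriv d (dir_deriv e f) p = L (dir_deriv (\<phi> d) (dir_deriv (\<phi> e) X) (\<phi> p))"
    if "d \<in> Basis" "e \<in> Basis" "p \<in> S" for d e p
    using B that(1)
    by (intro dir_deriv_eqI[OF dir_deriv_linear_change[OF C1'[OF that(2)] assms(2-5) 1[OF that(2)] _ that(3)]]) blast+
qed

section \<open>From the parametrised graph to its height function\<close>

lemma open_param_domain: "open \<Omega> \<Longrightarrow> open (param_domain \<Omega>)"
proof -
  have *: "param_domain \<Omega> = (\<lambda>w. (Re w, Im w)) -` \<Omega>" by (auto simp: param_domain_def)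
  show "open \<Omega> \<Longrightarrow> open (param_domain \<Omega>)"
    unfolding * by (erule open_vimage) (intro continuous_intros)
qed

lemma linear_Complex: "linear (\<lambda>(x, y). Complex x y)"
  by (auto intro!: linearI simp: complex_eq_iff)

lemma connected_param_domain:
  assumes "connected \<Omega>"
  shows "connected (param_domain \<Omega>)"
proof -
  have "param_domain \<Omega> = (\<lambda>(x, y). Complex x y) ` \<Omega>"
    by (force simp: param_domain_def image_iff)
  moreover have "continuous_on \<Omega> (\<lambda>(x, y). Complex x y)"
    by (rule linear_continuous_on) (rule linear_Complex[unfolded linear_conv_bounded_linear])
  ultimately show ?thesis
    using assms by (simp only: connected_continuous_image)
qed

text \<open>The horizontal part of the graph is the identity, so its first derivatives are constant
  and its second derivatives vanish. Only the third coordinate enters the curvature. The regularity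
  of \<open>h\<close> is inherited from \<open>X\<close>.\<close>

lemma harmonic_on_height_function:
  assumes "open \<Omega>" and min: "isotropic_minimal_surface (param_domain \<Omega>) (graph_param h)"
  shows "harmonic_on \<Omega> h"
proof -
  define U where "U = param_domain \<Omega>"
  define X where "X = graph_param h"
  define \<phi> where "\<phi> = (\<lambda>(x, y). Complex x y)"
  have C2: "C2_on U X" using min by (simp add: isotropic_minimal_surface_def U_def X_def)
  have "open U" unfolding U_def by (rule open_param_domain[OF assms(1)])
  have "linear \<phi>" unfolding \<phi>_def by (rule linear_Complex)
  have \<phi>U: "\<phi> p \<in> U" if "p \<in> \<Omega>" for p using that by (auto simp: \<phi>_def U_def param_domain_def split: prod.split)
  have \<phi>1: "\<phi> (1, 0) = 1" "\<phi> (0, 1) = \<i>" by (auto simp: \<phi>_def complex_eq_iff)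
  have B: "\<phi> ` Basis \<subseteq> Basis"
    using \<phi>1 by (auto simp: Basis_prod_def Basis_complex_def)
  \<comment> \<open>This writes \<open>h\<close> as a linear substitution in \<open>X\<close>; as
    \<open>\<phi>\<close> maps basis to basis, the partial derivatives correspond.\<close>
  have h: "h p = X (\<phi> p) $ 3" for p
    by (auto simp: X_def graph_param_def \<phi>_def split: prod.split)
  have X12: "X w $ 1 = Re w" "X w $ 2 = Im w" for w
    by (simp_all add: X_def graph_param_def)
  have X_: "((\<lambda>t. X (w + t *\<^sub>R d) $ j) has_vector_derivative dir_deriv d X w $ j) (at 0)"
    if "w \<in> U" "d \<in> Basis" for w d j
    using C2 that by (intro bounded_linear.has_vector_derivative[OF bounded_linear_vec_nth] dir_deriv_works)
      (auto simp: C2_on_def)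
  have X1: "dir_deriv d X w $ 1 = Re d" "dir_deriv d X w $ 2 = Im d"
    if "w \<in> U" "d \<in> Basis" for w d
  proof -
    have "((\<lambda>t. X (w + t *\<^sub>R d) $ 1) has_vector_derivative Re d) (at 0)"
      "((\<lambda>t. X (w + t *\<^sub>R d) $ 2) has_vector_derivative Im d) (at 0)"
      unfolding X12 by (auto intro!: derivative_eq_intros)
    then show "dir_deriv d X w $ 1 = Re d" "dir_deriv d X w $ 2 = Im d"
      using X_[OF that] vector_derivative_unique_at by blast+
  qed
  have X2: "dir_deriv e (dir_deriv d X) w $ 1 = 0" "dir_deriv e (dir_deriv d X) w $ 2 = 0"
    if "w \<in> U" "d \<in> Basis" "e \<in> Basis" for w d e
  proof -
    have D: "((\<lambda>t. dir_deriv d X (w + t *\<^sub>R e) $ j) has_vector_derivative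
        dir_deriv e (dir_deriv d X) w $ j) (at 0)" for j
      using C2 that by (intro bounded_linear.has_vector_derivative[OF bounded_linear_vec_nth] dir_deriv_works)
        (auto simp: C2_on_def)
    have "((\<lambda>t. Re d) has_vector_derivative dir_deriv e (dir_deriv d X) w $ 1) (at 0)"
      by (rule has_vector_derivative_along_line_cong[where g = "\<lambda>_. Re d", OF D \<open>open U\<close> \<open>w \<in> U\<close>])
        (simp add: X1 that)
    moreover have "((\<lambda>t. Im d) has_vector_derivative dir_deriv e (dir_deriv d X) w $ 2) (at 0)"
      by (rule has_vector_derivative_along_line_cong[where g = "\<lambda>_. Im d", OF D \<open>open U\<close> \<open>w \<in> U\<close>])
        (simp add: X1 that)
    ultimately show "dir_deriv e (dir_deriv d X) w $ 1 = 0" "dir_deriv e (dir_deriv d X) w $ 2 = 0"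
      using vector_derivative_unique_at has_vector_derivative_const by blast+
  qed
  have Basis: "1 \<in> (Basis :: complex set)" "\<i> \<in> (Basis :: complex set)"
    by (auto simp: Basis_complex_def)
  have lap: "dir_deriv 1 (dir_deriv 1 X) w $ 3 + dir_deriv \<i> (dir_deriv \<i> X) w $ 3 = 0"
    if w: "w \<in> U" for w
  proof -
    have in1: "iso_inner (dir_deriv 1 X w) (dir_deriv 1 X w) = 1"
      "iso_inner (dir_deriv 1 X w) (dir_deriv \<i> X w) = 0"
      "iso_inner (dir_deriv \<i> X w) (dir_deriv \<i> X w) = 1"
      using X1[OF w] Basis by (auto simp: iso_inner_def)
    then have disc: "iso_disc X w = 1" by (simp add: iso_disc_def)
    \<comment> \<open>The rows of the determinant start with (1, 0), (0, 1) and (0, 0), which leaves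
      the third entry of the last row.\<close>
    have "iso_second_form X w d d = dir_deriv d (dir_deriv d X) w $ 3" if "d \<in> Basis" for d
      unfolding iso_second_form_def disc
      using X1[OF w] X2[OF w] Basis that by (simp add: det_3)
    moreover have "iso_mean_curvature X w = 0"
      using min w by (simp add: isotropic_minimal_surface_def U_def X_def)
    ultimately show ?thesis
      using Basis by (simp add: iso_mean_curvature_def in1 disc)
  qed
  note change = C2_on_linear_change[OF C2 \<open>open \<Omega>\<close> bounded_linear_vec_nth \<open>linear \<phi>\<close> _ h B]
  have sub: "\<phi> ` \<Omega> \<subseteq> U" using \<phi>U by blast
  have "(\<Sum>d\<in>Basis. dir_deriv d (dir_deriv d h) p) = 0" if "p \<in> \<Omega>" for p
  proof -
    have "(\<Sum>d\<in>Basis. dir_deriv d (dir_deriv d h) p) =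
        dir_deriv (1, 0) (dir_deriv (1, 0) h) p + dir_deriv (0, 1) (dir_deriv (0, 1) h) p"
      by (simp add: Basis_prod_def)
    also have "\<dots> = dir_deriv 1 (dir_deriv 1 X) (\<phi> p) $ 3 + dir_deriv \<i> (dir_deriv \<i> X) (\<phi> p) $ 3"
      using change(2)[OF sub _ _ that] by (simp add: \<phi>1 Basis_prod_def)
    finally show ?thesis using lap[OF \<phi>U[OF that]] by simp
  qed
  then show ?thesis
    using change(1)[OF sub] unfolding harmonic_on_def by blast
qed

subsection \<open>Surfaces given by Weierstrass data\<close>

lemma has_vector_derivative_vec:
  fixes f :: "real \<Rightarrow> real ^ 'n"
  assumes "\<And>j. ((\<lambda>t. f t $ j) has_vector_derivative D $ j) (at x)"
  shows "(f has_vector_derivative D) (at x)"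
  unfolding has_vector_derivative_def
  by (subst has_derivative_componentwise_within)
    (use assms in \<open>auto simp: has_vector_derivative_def Basis_vec_def inner_axis\<close>)

text \<open>The complex chain rule along a line multiplies the derivative by \<open>d\<close>. Thus
  \<open>d = \<i>\<close> turns the derivative in \<open>v\<close> into
  \<open>Re (\<i> \<Phi>')\<close>, which encodes the Cauchy-Riemann equations.\<close>

lemma has_vector_derivative_Re_vec:
  assumes "\<And>j. ((\<lambda>w. \<Phi> w $ j) has_field_derivative \<Phi>' $ j) (at w)"
  shows "((\<lambda>t. Re_vec (\<Phi> (w + t *\<^sub>R d))) has_vector_derivative Re_vec (d *s \<Phi>')) (at 0)"
proof (rule has_vector_derivative_vec)
  fix j
  have "((\<lambda>t. w + t *\<^sub>R d) has_vector_derivative d) (at 0)"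
    by (auto intro!: derivative_eq_intros)
  moreover have "((\<lambda>w. \<Phi> w $ j) has_field_derivative \<Phi>' $ j) (at (w + 0 *\<^sub>R d))"
    using assms by simp
  ultimately have "((\<lambda>w. \<Phi> w $ j) \<circ> (\<lambda>t. w + t *\<^sub>R d) has_vector_derivative d * \<Phi>' $ j) (at 0)"
    by (rule field_vector_diff_chain_at)
  from bounded_linear.has_vector_derivative[OF bounded_linear_Re this]
  show "((\<lambda>t. Re_vec (\<Phi> (w + t *\<^sub>R d)) $ j) has_vector_derivative Re_vec (d *s \<Phi>') $ j) (at 0)"
    by (simp add: Re_vec_def o_def)
qed

lemma continuous_on_Re_vec:
  assumes "\<And>j. continuous_on U (\<lambda>w. \<Phi> w $ j)"
  shows "continuous_on U (\<lambda>w. Re_vec (\<Phi> w))"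
  unfolding Re_vec_def by (intro continuous_on_vec_lambda continuous_on_Re assms)

text \<open>Holomorphy of the data gives \<open>X\<^sub>u\<^sub>u + X\<^sub>v\<^sub>v = 0\<close>, and the metric is conformal with factor \<open>|F|\<^sup>2\<close>.\<close>

lemma isotropic_minimal_weierstrass_surface:
  assumes "open U" and X: "weierstrass_surface U F G X" and F: "\<And>w. w \<in> U \<Longrightarrow> F w \<noteq> 0"
  shows "isotropic_minimal_surface U X"
proof -
  obtain \<Phi> where \<Phi>: "weierstrass_primitive U F G \<Phi>" "\<And>w. w \<in> U \<Longrightarrow> Re_vec (\<Phi> w) = X w"
    using X unfolding weierstrass_surface_def by auto
  define \<Phi>1 where "\<Phi>1 = (\<lambda>w. vector [F w, - \<i> * F w, 2 * G w * F w] :: complex^3)"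
  define \<Phi>2 where "\<Phi>2 = (\<lambda>w. \<chi> j. deriv (\<lambda>w. \<Phi>1 w $ j) w)"
  have hol: "F holomorphic_on U" "G holomorphic_on U"
    and d1: "\<And>w j. w \<in> U \<Longrightarrow> ((\<lambda>w. \<Phi> w $ j) has_field_derivative \<Phi>1 w $ j) (at w)"
    using \<Phi>(1) by (auto simp: weierstrass_primitive_def \<Phi>1_def)
  have "\<forall>j. (\<lambda>w. \<Phi>1 w $ j) holomorphic_on U"
    unfolding forall_3 \<Phi>1_def vector_3 using hol by (intro conjI holomorphic_intros)
  then have hol1: "(\<lambda>w. \<Phi>1 w $ j) holomorphic_on U" for j by blast
  then have hol2: "(\<lambda>w. \<Phi>2 w $ j) holomorphic_on U" for j
    unfolding \<Phi>2_def using \<open>open U\<close> by (simp add: holomorphic_deriv)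
  have d2: "((\<lambda>w. \<Phi>1 w $ j) has_field_derivative \<Phi>2 w $ j) (at w)" if "w \<in> U" for w j
    unfolding \<Phi>2_def vec_lambda_beta using hol1 \<open>open U\<close> that by (rule holomorphic_derivI)
  have D1: "((\<lambda>t. X (w + t *\<^sub>R d)) has_vector_derivative Re_vec (d *s \<Phi>1 w)) (at 0)"
    if "w \<in> U" for w d
    using has_vector_derivative_Re_vec[OF d1[OF that]] \<open>open U\<close> that \<Phi>(2)
    by (rule has_vector_derivative_along_line_cong)
  have X1: "Re_vec (e *s \<Phi>1 w) = dir_deriv e X w" if "w \<in> U" for w e
    using dir_deriv_eqI[OF D1[OF that]] by simp
  have D2: "((\<lambda>t. dir_deriv e X (w + t *\<^sub>R d)) has_vector_derivative Re_vec (d *s (e *s \<Phi>2 w))) (at 0)"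
    if "w \<in> U" for w d e
  proof -
    have "((\<lambda>w. (e *s \<Phi>1 w) $ j) has_field_derivative (e *s \<Phi>2 w) $ j) (at w)" for j
      unfolding vector_smult_component by (rule DERIV_cmult[OF d2[OF that]])
    from has_vector_derivative_Re_vec[OF this] \<open>open U\<close> that X1
    show ?thesis by (rule has_vector_derivative_along_line_cong)
  qed
  have X2: "dir_deriv d (dir_deriv e X) w = Re_vec (d *s (e *s \<Phi>2 w))" if "w \<in> U" for w d e
    by (rule dir_deriv_eqI[OF D2[OF that]])
  have "C2_on U X"
    unfolding C2_on_def
  proof safe
    show "C1_on U X"
      by (rule C1_onI[OF D1], assumption, intro continuous_on_Re_vec, unfold vector_smult_component)
        (intro continuous_intros holomorphic_on_imp_continuous_on[OF hol1])
    show "C1_on U (dir_deriv e X)" for e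
      by (rule C1_onI[OF D2], assumption, intro continuous_on_Re_vec, unfold vector_smult_component)
        (intro continuous_intros holomorphic_on_imp_continuous_on[OF hol2])
  qed
  moreover have "iso_disc X w > 0 \<and> iso_mean_curvature X w = 0" if w: "w \<in> U" for w
  proof -
    \<comment> \<open>The horizontal parts of the two derivatives are \<open>F\<close> and
      \<open>\<i> * F\<close> read as plane vectors: orthogonal and of equal length.\<close>
    have in1: "iso_inner (dir_deriv 1 X w) (dir_deriv 1 X w) = (norm (F w))\<^sup>2"
      "iso_inner (dir_deriv 1 X w) (dir_deriv \<i> X w) = 0"
      "iso_inner (dir_deriv \<i> X w) (dir_deriv \<i> X w) = (norm (F w))\<^sup>2"
      by (simp_all add: X1[OF w, symmetric] iso_inner_def Re_vec_def \<Phi>1_def cmod_power2 flip: power2_eq_square)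
    then have disc: "iso_disc X w = ((norm (F w))\<^sup>2)\<^sup>2"
      by (simp add: iso_disc_def power2_eq_square)
    \<comment> \<open>Differentiating twice in direction \<open>\<i>\<close> multiplies
      \<open>\<Phi>2\<close> by -1. The determinant is linear in its last row, so the two diagonal
      terms of the mean curvature cancel.\<close>
    have "dir_deriv \<i> (dir_deriv \<i> X) w = - dir_deriv 1 (dir_deriv 1 X) w"
      by (simp add: X2[OF w] Re_vec_def vec_eq_iff)
    then have "iso_second_form X w \<i> \<i> = - iso_second_form X w 1 1"
      by (simp add: iso_second_form_def det_3 flip: minus_divide_left) (simp add: algebra_simps diff_divide_distrib add_divide_distrib)
    then show ?thesis
      using F[OF w] by (simp add: iso_mean_curvature_def in1 disc)
  qed
  ultimately show ?thesis by (simp add: isotropic_minimal_surface_def)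
qed

text \<open>Two primitives differ componentwise by a function of zero derivative, which is constant
  on a connected open set. This settles the choice of integration constants.\<close>

lemma weierstrass_surface_unique_up_to_translation:
  assumes "open U" "connected U" "weierstrass_surface U F G X" "weierstrass_surface U F G Y"
  shows "\<exists>t. \<forall>w\<in>U. Y w = X w + t"
proof -
  obtain \<Phi> \<Psi> where \<Phi>: "weierstrass_primitive U F G \<Phi>" "\<And>w. w \<in> U \<Longrightarrow> X w = Re_vec (\<Phi> w)"
    and \<Psi>: "weierstrass_primitive U F G \<Psi>" "\<And>w. w \<in> U \<Longrightarrow> Y w = Re_vec (\<Psi> w)"
    using assms(3,4) unfolding weierstrass_surface_def by blast
  have "\<exists>t. \<forall>w\<in>U. \<Psi> w $ j - \<Phi> w $ j = t" for j
  proof -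
    have D: "((\<lambda>w. \<Psi> w $ j - \<Phi> w $ j) has_field_derivative 0) (at w)" if "w \<in> U" for w
      using \<Phi>(1) \<Psi>(1) that DERIV_diff[of "\<lambda>w. \<Psi> w $ j" _ w UNIV "\<lambda>w. \<Phi> w $ j"]
      unfolding weierstrass_primitive_def by fastforce
    then have "continuous_on U (\<lambda>w. \<Psi> w $ j - \<Phi> w $ j)"
      by (meson DERIV_isCont continuous_at_imp_continuous_on)
    \<comment> \<open>The exceptional set permitted by the library fact is taken empty.\<close>
    from DERIV_zero_connected_constant[OF \<open>connected U\<close> \<open>open U\<close> finite.emptyI this]
    show ?thesis using D by (metis Diff_empty)
  qed
  then obtain t where t: "\<And>j w. w \<in> U \<Longrightarrow> \<Psi> w $ j - \<Phi> w $ j = t j" by metis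
  have "Y w = X w + (\<chi> j. Re (t j))" if "w \<in> U" for w
    using t[OF that] by (simp add: \<Phi>(2)[OF that] \<Psi>(2)[OF that] Re_vec_def vec_eq_iff flip: t[OF that])
  then show ?thesis by blast
qed

text \<open>With \<open>k = exp (\<i> * \<theta>) / l\<close>, the deformation scales the first two
  integrands by \<open>k\<close> and the third by \<open>l * k\<close>: the effect of replacing
  \<open>(1, G)\<close> by \<open>(k, l * G)\<close>.\<close>

lemma weierstrass_surface_bonnet_lopez_ros:
  assumes \<Phi>: "weierstrass_primitive U (\<lambda>_. 1) G \<Phi>" and "l \<noteq> 0"
  shows "weierstrass_surface U (\<lambda>_. exp (\<i> * of_real \<theta>) / of_real l) (\<lambda>w. of_real l * G w)
    (bonnet_lopez_ros \<theta> l \<Phi>)"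
proof -
  define \<Psi> where "\<Psi> = (\<lambda>w. (exp (\<i> * of_real \<theta>) / of_real l) *s
       (vector [\<Phi> w $ 1, \<Phi> w $ 2, of_real l * \<Phi> w $ 3] :: complex^3))"
  define k where "k = exp (\<i> * of_real \<theta>) / of_real l"
  have "weierstrass_primitive U (\<lambda>_. k) (\<lambda>w. of_real l * G w) \<Psi>"
    unfolding weierstrass_primitive_def
  proof (intro conjI ballI)
    show "(\<lambda>w. of_real l * G w) holomorphic_on U"
      using \<Phi> by (auto simp: weierstrass_primitive_def intro!: holomorphic_intros)
    fix w assume w: "w \<in> U"
    have D: "((\<lambda>w. \<Phi> w $ 1) has_field_derivative 1) (at w)"
      "((\<lambda>w. \<Phi> w $ 2) has_field_derivative - \<i>) (at w)"
      "((\<lambda>w. \<Phi> w $ 3) has_field_derivative 2 * G w) (at w)"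
      using \<Phi> w by (simp_all add: weierstrass_primitive_def forall_3)
    show "\<forall>j. ((\<lambda>w. \<Psi> w $ j) has_field_derivative
        (vector [k, - \<i> * k, 2 * (of_real l * G w) * k] :: complex^3) $ j) (at w)"
      unfolding forall_3 \<Psi>_def k_def[symmetric] vector_smult_component vector_3
      by (intro conjI) (auto intro!: derivative_eq_intros D)
  qed auto
  then show ?thesis
    unfolding weierstrass_surface_def k_def \<Psi>_def by (auto simp: bonnet_lopez_ros_def)
qed

subsection \<open>The components of the deformed height\<close>

lemma exp_i_eq_cis: "exp (\<i> * of_real \<theta>) = cis \<theta>"
  by (simp add: cis_conv_exp)

lemma h_Enpr_eq: "h_Enpr a n z = Re (a * z ^ n)"
proof -
  have "a * z ^ n + cnj a * cnj z ^ n = of_real (2 * Re (a * z ^ n))"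
    using complex_add_cnj[of "a * z ^ n"] by simp
  then show ?thesis by (simp add: h_Enpr_def del: of_real_mult)
qed

lemma h_dil_Enpr_eq: "h_dil_Enpr c \<theta> l n p = Re (c n * inv (A_C \<theta> l) p ^ n)"
  by (simp only: h_dil_Enpr_def h_Enpr_eq)

text \<open>Rotating the variable by \<open>pi / (2 * n)\<close> multiplies its \<open>n\<close>-th
  power by \<open>\<i>\<close>, so this rotation gives the height of the Bonnet rotation by a
  quarter turn. For \<open>n = 0\<close> the power would be 1 instead.\<close>

lemma h_conj_dil_Enpr_eq:
  assumes "n > 0"
  shows "h_conj_dil_Enpr c \<theta> l n p = Re (\<i> * (c n * inv (A_C \<theta> l) p ^ n))"
proof -
  have "exp (\<i> * of_real pi / (2 * of_nat n)) ^ n = exp (\<i> * of_real pi / 2)"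
    using assms by (simp flip: exp_of_nat_mult)
  also have "\<dots> = \<i>"
    using exp_i_eq_cis[of "pi / 2"] by simp
  finally show ?thesis
    unfolding h_conj_dil_Enpr_def h_Enpr_eq power_mult_distrib by (simp only: mult.left_commute)
qed

text \<open>The third component integrates \<open>2 * G\<close>, hence the factor
  \<open>n / 2\<close> in the data.\<close>

lemma weierstrass_primitive_monomial:
  assumes "n > 0"
  shows "weierstrass_primitive UNIV (\<lambda>_. 1) (\<lambda>w. (of_nat n * a / 2) * w ^ (n - 1))
    (\<lambda>w. vector [w, - \<i> * w, a * w ^ n])"
  unfolding weierstrass_primitive_def forall_3 vector_3 using assms
  by (intro conjI ballI holomorphic_intros) (auto intro!: derivative_eq_intros)

text \<open>The second coordinate agrees because \<open>Re (- \<i> * w) = Im w\<close>.\<close>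

lemma graph_param_eq_Re_vec:
  "h (Re w, Im w) = Re z \<Longrightarrow> graph_param h w = Re_vec (vector [w, - \<i> * w, z])"
  by (simp add: graph_param_def Re_vec_def vec_eq_iff forall_3)

section \<open>Enneper graphs, their dilated copies and their conjugates\<close>

lemma isotropic_generalised_Enneper_graph:
  assumes "n > 0" and "\<And>x y. h (x, y) = Re (a * Complex x y ^ n)"
  shows "isotropic_generalised_Enneper n (graph_param h)"
proof -
  have "graph_param h w = Re_vec (vector [w, - \<i> * w, a * w ^ n])" for w
    by (rule graph_param_eq_Re_vec) (simp only: assms(2) complex_surj)
  then show ?thesis
    unfolding isotropic_generalised_Enneper_def weierstrass_surface_def
    using weierstrass_primitive_monomial[OF \<open>n > 0\<close>, of a] by blast
qed

lemma dilated_rotated_range: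
  assumes "r > 0"
  shows "dilated_rotated (range (\<lambda>w. vector [Re (u w), Im (u w), g w]))
    (range (\<lambda>w. vector [Re (of_real r * cis \<alpha> * u w), Im (of_real r * cis \<alpha> * u w), g w]))"
  unfolding dilated_rotated_def image_image using assms
  by (intro exI[of _ r] conjI exI[of _ \<alpha>]) (simp_all add: algebra_simps)

lemma graph_over_A_C:
  "graph_over (A_C \<theta> l ` U) k =
    (\<lambda>w. vector [Re (cis \<theta> * w / of_real l), Im (cis \<theta> * w / of_real l), k (A_C \<theta> l w)]) ` U"
  by (auto simp: graph_over_def A_C_cis image_iff)

lemma graph_over_UNIV_A_C:
  assumes "l \<noteq> 0"
  shows "graph_over UNIV k =
    range (\<lambda>w. vector [Re (of_real (1 / l) * cis \<theta> * w), Im (of_real (1 / l) * cis \<theta> * w), k (A_C \<theta> l w)])"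
  using graph_over_A_C[of \<theta> l UNIV k] bij_is_surj[OF inv_A_C(1)[OF assms, of \<theta>]] by simp

lemma graph_over_UNIV: "graph_over UNIV k = range (\<lambda>w. vector [Re w, Im w, k (Re w, Im w)])"
  using graph_over_UNIV_A_C[of 1 k 0] by (simp add: A_C_def)

text \<open>Parametrised by \<open>A_C\<close>, the height at \<open>w\<close> is that of the
  original surface, while the horizontal position is multiplied by \<open>cis \<theta> / l\<close>:
  ratio \<open>1 / l\<close>, angle \<open>\<theta>\<close>.\<close>

lemma dilated_rotated_h_dil_Enpr:
  assumes "l > 0"
  shows "dilated_rotated (graph_over UNIV (\<lambda>(x, y). h_Enpr (c n) n (Complex x y)))
    (graph_over UNIV (h_dil_Enpr c \<theta> l n))"
proof -
  have "h_dil_Enpr c \<theta> l n (A_C \<theta> l w) = h_Enpr (c n) n w" for w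
    using inv_A_C(1)[of l \<theta>] assms by (simp add: h_dil_Enpr_def bij_is_inj)
  then show ?thesis
    using dilated_rotated_range[of "1 / l" "\<lambda>w. w" _ \<theta>] assms
    by (simp add: graph_over_UNIV_A_C[of l _ \<theta>] graph_over_UNIV[of "\<lambda>(x, y). _ x y"])
qed

text \<open>The conjugate is the real part of \<open>\<i> *s \<Phi>\<close>. Its horizontal position
  is \<open>\<i> * w\<close> and its height \<open>Re (\<i> * (c n * w ^ n))\<close>, the conjugate
  height over \<open>A_C \<theta> l w\<close>.\<close>

lemma conjugate_Enneper:
  assumes "n > 0" "l > 0"
  shows "\<exists>Z. conjugate_surface UNIV (graph_param (\<lambda>(x, y). h_Enpr (c n) n (Complex x y))) Z \<and>
    dilated_rotated (range Z) (graph_over UNIV (h_conj_dil_Enpr c \<theta> l n))"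
proof (intro exI conjI)
  define \<Phi> where "\<Phi> = (\<lambda>w. vector [w, - \<i> * w, c n * w ^ n] :: complex^3)"
  show "conjugate_surface UNIV (graph_param (\<lambda>(x, y). h_Enpr (c n) n (Complex x y)))
      (\<lambda>w. Re_vec (\<i> *s \<Phi> w))"
    unfolding conjugate_surface_def
    using weierstrass_primitive_monomial[OF \<open>n > 0\<close>, of "c n"]
    by (fastforce simp: \<Phi>_def h_Enpr_eq intro: graph_param_eq_Re_vec)
  have Z: "Re_vec (\<i> *s \<Phi> w) = vector [Re (\<i> * w), Im (\<i> * w), Re (\<i> * (c n * w ^ n))]" for w
    by (simp add: \<Phi>_def Re_vec_def vec_eq_iff forall_3)
  have height: "h_conj_dil_Enpr c \<theta> l n (A_C \<theta> l w) = Re (\<i> * (c n * w ^ n))" for w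
    using inv_A_C(1)[of l \<theta>] assms by (simp add: h_conj_dil_Enpr_eq bij_is_inj)
  \<comment> \<open>The conjugate has already turned the horizontal plane by \<open>pi / 2\<close>,
    so the remaining angle is \<open>\<theta> - pi / 2\<close>.\<close>
  have "cis (\<theta> - pi / 2) * \<i> = cis \<theta>"
    by (simp add: complex_eq_iff cos_diff sin_diff)
  then have rot: "of_real (1 / l) * cis (\<theta> - pi / 2) * (\<i> * w) = of_real (1 / l) * cis \<theta> * w" for w
    by (metis mult.assoc)
  have "l \<noteq> 0" "0 < 1 / l" using assms by auto
  show "dilated_rotated (range (\<lambda>w. Re_vec (\<i> *s \<Phi> w))) (graph_over UNIV (h_conj_dil_Enpr c \<theta> l n))"
    using dilated_rotated_range[OF \<open>0 < 1 / l\<close>, of "\<lambda>w. \<i> * w" "\<lambda>w. Re (\<i> * (c n * w ^ n))" "\<theta> - pi / 2"]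
    unfolding Z graph_over_UNIV_A_C[OF \<open>l \<noteq> 0\<close>, of _ \<theta>] by (simp only: rot height)
qed

section \<open>Planes as graphs of affine functions\<close>

lemma is_plane_affine_graph:
  fixes a b e :: real
  assumes "\<And>x y. k (x, y) = a * x + b * y + e"
  shows "is_plane (graph_over UNIV k)"
proof -
  define L where "L = (\<lambda>p. vector [fst p, snd p, a * fst p + b * snd p] :: real^3)"
  have L: "linear L"
    by (rule linearI) (auto simp: L_def vec_eq_iff forall_3 algebra_simps)
  have "inj L"
    by (rule injI) (auto simp: L_def vec_eq_iff forall_3 prod_eq_iff)
  \<comment> \<open>A translate of the image of the plane under an injective linear map, hence
    affine of dimension 2.\<close>
  have "graph_over UNIV k = (+) (vector [0, 0, e]) ` range L"
    unfolding graph_over_def L_def image_image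
    by (force simp: assms vec_eq_iff forall_3 image_iff)
  moreover have "affine (range L)"
    by (intro subspace_imp_affine linear_subspace_image L subspace_UNIV)
  ultimately show ?thesis
    unfolding is_plane_def using \<open>inj L\<close> L
    by (simp add: aff_dim_translation_eq affine_translation[symmetric])
qed

lemma constant_graph_parallel:
  assumes "\<And>p. k p = e"
  shows "affine_parallel (graph_over UNIV k) {v. v $ 3 = 0}"
proof -
  have "{v. v $ 3 = 0} = (\<lambda>v. vector [0, 0, - e] + v) ` graph_over UNIV k"
  proof (intro equalityI subsetI)
    fix v :: "real^3" assume "v \<in> {v. v $ 3 = 0}"
    then have "v = vector [0, 0, - e] + vector [v $ 1, v $ 2, k (v $ 1, v $ 2)]"
      by (simp add: vec_eq_iff forall_3 assms)
    then show "v \<in> (\<lambda>v. vector [0, 0, - e] + v) ` graph_over UNIV k"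
      unfolding graph_over_def by blast
  qed (auto simp: graph_over_def assms)
  then show ?thesis unfolding affine_parallel_def by blast
qed

lemma is_plane_plane0: "is_plane (graph_over UNIV (plane0 c \<theta>))"
  and plane0_parallel: "affine_parallel (graph_over UNIV (plane0 c \<theta>)) {v. v $ 3 = 0}"
  by (rule is_plane_affine_graph[where a = 0 and b = 0 and e = "plane0 c \<theta> (0, 0)"], simp add: plane0_def)
    (rule constant_graph_parallel, rule plane0_def)

lemma plane0_eq: "plane0 c \<theta> p = Re (cis \<theta> * c 0) / 2"
  by (simp add: plane0_def algebra_simps)

lemma plane1_eq: "plane1 c \<theta> l p = Re (c 1 * inv (A_C \<theta> l) p * exp (\<i> * of_real \<theta>) / 2)"
  by (simp add: plane1_def exp_i_eq_cis cis_conv_exp exp_Euler cos_of_real sin_of_real)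

text \<open>The inverse of \<open>A_C\<close> is multiplication by a complex constant, so the height
  is the real part of a constant times \<open>x + iy\<close>.\<close>

lemma is_plane_plane1:
  assumes "l \<noteq> 0"
  shows "is_plane (graph_over UNIV (plane1 c \<theta> l))"
proof -
  define k where "k = c 1 * of_real l * cis (- \<theta>) * exp (\<i> * of_real \<theta>) / 2"
  have "plane1 c \<theta> l (x, y) = Re (k * Complex x y)" for x y
    unfolding plane1_eq inv_A_C(2)[OF assms] k_def
    by (rule arg_cong[where f = Re]) (simp add: mult_ac)
  then show ?thesis
    by (intro is_plane_affine_graph[where a = "Re k" and b = "- Im k" and e = 0]) simp
qed

text \<open>The constant by which the inverse of \<open>A_C\<close> multiplies is absorbed, with its
  \<open>n\<close>-th power, into the coefficient of the monomial.\<close>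

lemma isotropic_generalised_Enneper_dil:
  assumes "n > 0" "l \<noteq> 0"
  shows "isotropic_generalised_Enneper n (graph_param (h_dil_Enpr c \<theta> l n))"
    and "isotropic_generalised_Enneper n (graph_param (h_conj_dil_Enpr c \<theta> l n))"
  by (rule isotropic_generalised_Enneper_graph[where a = "c n * (of_real l * cis (- \<theta>)) ^ n", OF assms(1)],
      simp only: h_dil_Enpr_eq inv_A_C(2)[OF assms(2)] power_mult_distrib mult.assoc)
    (rule isotropic_generalised_Enneper_graph[where a = "\<i> * c n * (of_real l * cis (- \<theta>)) ^ n", OF assms(1)],
      simp only: h_conj_dil_Enpr_eq[OF assms(1)] inv_A_C(2)[OF assms(2)] power_mult_distrib mult.assoc)

text \<open>After the terms of degree 0 and 1 are split off, \<open>Re (cis \<theta> * u) = cos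
  \<theta> * Re u + sin \<theta> * Re (\<i> * u)\<close> is applied to the sum \<open>u\<close> of
  the tail, and each real part is moved inside its series.\<close>

lemma deformed_height_decomposition:
  assumes z: "z = inv (A_C \<theta> l) p" and f: "(\<lambda>n. 2 * c n * z ^ n) sums s"
    and abs: "summable (\<lambda>n. c n * z ^ n)"
  shows "summable (\<lambda>n. cos \<theta> * h_dil_Enpr c \<theta> l (n + 2) p)"
    and "summable (\<lambda>n. sin \<theta> * h_conj_dil_Enpr c \<theta> l (n + 2) p)"
    and "Re (cis \<theta> * s) = 4 * plane0 c \<theta> p + 4 * plane1 c \<theta> l p
      + 2 * (\<Sum>n. cos \<theta> * h_dil_Enpr c \<theta> l (n + 2) p)
      + 2 * (\<Sum>n. sin \<theta> * h_conj_dil_Enpr c \<theta> l (n + 2) p)"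
proof -
  define b where "b = (\<lambda>n. c (n + 2) * z ^ (n + 2))"
  have b: "summable b" unfolding b_def using abs by (rule summable_ignore_initial_segment)
  have D: "h_dil_Enpr c \<theta> l (n + 2) p = Re (b n)"
    and E: "h_conj_dil_Enpr c \<theta> l (n + 2) p = Re (\<i> * b n)" for n
    by (simp_all only: h_dil_Enpr_eq h_conj_dil_Enpr_eq b_def z)
  have sD: "summable (\<lambda>n. Re (b n))" and sE: "summable (\<lambda>n. Re (\<i> * b n))"
    by (rule summable_Re[OF b], rule summable_Re[OF summable_mult[OF b]])
  from summable_mult[OF sD] summable_mult[OF sE]
  show "summable (\<lambda>n. cos \<theta> * h_dil_Enpr c \<theta> l (n + 2) p)"
    "summable (\<lambda>n. sin \<theta> * h_conj_dil_Enpr c \<theta> l (n + 2) p)"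
    unfolding D E by blast+
  have "s = (\<Sum>n. 2 * (c n * z ^ n))"
    using sums_unique[OF f] by (simp add: mult.assoc)
  also have "\<dots> = 2 * (\<Sum>n. c n * z ^ n)" by (rule suminf_mult[OF abs])
  also have "(\<Sum>n. c n * z ^ n) = suminf b + (c 0 + c 1 * z)"
    using suminf_split_initial_segment[OF abs, of 2] by (simp add: b_def numeral_2_eq_2)
  finally have "Re (cis \<theta> * s) = 2 * Re (cis \<theta> * c 0) + 2 * Re (c 1 * z * cis \<theta>)
      + 2 * (cos \<theta> * Re (suminf b)) + 2 * (sin \<theta> * Re (\<i> * suminf b))"
    by (simp add: algebra_simps)
  moreover have "cos \<theta> * Re (suminf b) = (\<Sum>n. cos \<theta> * Re (b n))"
    using suminf_mult[OF sD] by (simp add: Re_suminf[OF b])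
  moreover have "sin \<theta> * Re (\<i> * suminf b) = (\<Sum>n. sin \<theta> * Re (\<i> * b n))"
    using suminf_mult[OF sE] Re_suminf[OF summable_mult[OF b]] suminf_mult[OF b, of \<i>] by metis
  moreover have "4 * plane1 c \<theta> l p = 2 * Re (c 1 * z * cis \<theta>)"
    unfolding plane1_eq exp_i_eq_cis z by simp
  moreover have "4 * plane0 c \<theta> p = 2 * Re (cis \<theta> * c 0)"
    unfolding plane0_eq by simp
  ultimately show "Re (cis \<theta> * s) = 4 * plane0 c \<theta> p + 4 * plane1 c \<theta> l p
      + 2 * (\<Sum>n. cos \<theta> * h_dil_Enpr c \<theta> l (n + 2) p)
      + 2 * (\<Sum>n. sin \<theta> * h_conj_dil_Enpr c \<theta> l (n + 2) p)"
    unfolding D E by linarith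
qed

text \<open>\<open>\<Phi>\<close> is chosen before \<open>\<theta>\<close> and \<open>l\<close>, so
  one set of integration constants serves all deformations; the clause on \<open>Y\<close> covers
  every other choice up to translation. The shift \<open>n + 2\<close> starts the Enneper sums at
  degree 2.\<close>

theorem theorem3p12:
  fixes \<Omega> :: "(real \<times> real) set" and h :: "real \<times> real \<Rightarrow> real"
  assumes "open \<Omega>" and "connected \<Omega>"
    and "isotropic_minimal_surface (param_domain \<Omega>) (graph_param h)"
  shows "harmonic_on \<Omega> h \<and>
    (\<forall>c :: nat \<Rightarrow> complex.
      (\<forall>(x, y)\<in>\<Omega>. (\<lambda>n. c n * Complex x y ^ n + cnj (c n) * cnj (Complex x y) ^ n)
         sums complex_of_real (h (x, y)))
      \<longrightarrow>
      (\<exists>G \<Phi>.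
        weierstrass_primitive (param_domain \<Omega>) (\<lambda>_. 1) G \<Phi> \<and>
        (\<forall>w\<in>param_domain \<Omega>. graph_param h w = Re_vec (\<Phi> w)) \<and>
        (\<forall>w\<in>param_domain \<Omega>. \<Phi> w $ 1 = w \<and> \<Phi> w $ 2 = - \<i> * w \<and>
           (\<lambda>n. 2 * c n * w ^ n) sums (\<Phi> w $ 3)) \<and>
        (\<forall>\<theta>\<in>{0<..2*pi}. \<forall>l::real. l > 0 \<longrightarrow>
          weierstrass_surface (param_domain \<Omega>) (\<lambda>_. exp (\<i> * of_real \<theta>) / of_real l)
            (\<lambda>w. of_real l * G w) (bonnet_lopez_ros \<theta> l \<Phi>) \<and>
          (\<forall>Y. weierstrass_surface (param_domain \<Omega>) (\<lambda>_. exp (\<i> * of_real \<theta>) / of_real l)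
                 (\<lambda>w. of_real l * G w) Y \<longrightarrow>
               (\<exists>t. \<forall>w\<in>param_domain \<Omega>. Y w = bonnet_lopez_ros \<theta> l \<Phi> w + t)) \<and>
          isotropic_minimal_surface (param_domain \<Omega>) (bonnet_lopez_ros \<theta> l \<Phi>) \<and>
          (\<exists>h'. bonnet_lopez_ros \<theta> l \<Phi> ` param_domain \<Omega>
                  = graph_over (A_C \<theta> l ` param_domain \<Omega>) h' \<and>
            (\<forall>p\<in>A_C \<theta> l ` param_domain \<Omega>.
              summable (\<lambda>n. cos \<theta> * h_dil_Enpr c \<theta> l (n + 2) p) \<and>
              summable (\<lambda>n. sin \<theta> * h_conj_dil_Enpr c \<theta> l (n + 2) p) \<and>
              h' p = 4 * plane0 c \<theta> p + 4 * plane1 c \<theta> l p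
                   + 2 * (\<Sum>n. cos \<theta> * h_dil_Enpr c \<theta> l (n + 2) p)
                   + 2 * (\<Sum>n. sin \<theta> * h_conj_dil_Enpr c \<theta> l (n + 2) p))) \<and>
          is_plane (graph_over UNIV (plane0 c \<theta>)) \<and>
          affine_parallel (graph_over UNIV (plane0 c \<theta>)) {v. v $ 3 = 0} \<and>
          is_plane (graph_over UNIV (plane1 c \<theta> l)) \<and>
          (\<forall>p. plane1 c \<theta> l p = Re (c 1 * inv (A_C \<theta> l) p * exp (\<i> * of_real \<theta>) / 2)) \<and>
          (\<forall>n\<ge>2.
            isotropic_generalised_Enneper n (graph_param (\<lambda>(x, y). h_Enpr (c n) n (Complex x y))) \<and>
            dilated_rotated (graph_over UNIV (\<lambda>(x, y). h_Enpr (c n) n (Complex x y)))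
              (graph_over UNIV (h_dil_Enpr c \<theta> l n)) \<and>
            (\<exists>Z. conjugate_surface UNIV (graph_param (\<lambda>(x, y). h_Enpr (c n) n (Complex x y))) Z \<and>
                 dilated_rotated (range Z) (graph_over UNIV (h_conj_dil_Enpr c \<theta> l n))) \<and>
            isotropic_generalised_Enneper n (graph_param (h_dil_Enpr c \<theta> l n)) \<and>
            isotropic_generalised_Enneper n (graph_param (h_conj_dil_Enpr c \<theta> l n))))))"
proof (intro conjI allI impI)
  show "harmonic_on \<Omega> h"
    using assms(1,3) by (rule harmonic_on_height_function)
next
  fix c :: "nat \<Rightarrow> complex"
  assume ser: "\<forall>(x, y)\<in>\<Omega>. (\<lambda>n. c n * Complex x y ^ n + cnj (c n) * cnj (Complex x y) ^ n)
    sums complex_of_real (h (x, y))"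
  define U where "U = param_domain \<Omega>"
  have "open U" and "connected U"
    unfolding U_def using assms(1,2) by (simp_all add: open_param_domain connected_param_domain)
  \<comment> \<open>A term plus its conjugate is twice its real part, so \<open>h\<close> is the
    real part of the series with coefficients \<open>2 * c n\<close>.\<close>
  define b where "b = (\<lambda>n. 2 * c n)"
  have h: "(\<lambda>n. Re (b n * w ^ n)) sums h (Re w, Im w)" if "w \<in> U" for w
  proof -
    have eq: "c n * w ^ n + cnj (c n) * cnj w ^ n = of_real (Re (b n * w ^ n))" for n
      using complex_add_cnj[of "c n * w ^ n"] by (simp add: b_def mult.assoc)
    have "(Re w, Im w) \<in> \<Omega>" using that by (simp add: U_def param_domain_def)
    with ser have "(\<lambda>n. c n * w ^ n + cnj (c n) * cnj w ^ n) sums complex_of_real (h (Re w, Im w))"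
      by force
    then show ?thesis unfolding eq by (simp only: sums_of_real_iff)
  qed
  \<comment> \<open>The real parts of the terms tend to 0 on \<open>U\<close> since their series
    converges. Convergence at a point of larger norm then gives summability and complex
    differentiability at \<open>w\<close>.\<close>
  have conv: "\<exists>K. norm w < norm K \<and> summable (\<lambda>n. b n * K ^ n)" if "w \<in> U" for w
    using \<open>open U\<close> summable_LIMSEQ_zero[OF sums_summable[OF h]] that
    by (rule power_series_converges_beyond_if_Re_tendsto_0)
  have summ: "summable (\<lambda>n. b n * w ^ n)" if "w \<in> U" for w
    using conv[OF that] powser_inside by blast
  define f where "f = (\<lambda>w. \<Sum>n. b n * w ^ n)"
  have f: "(\<lambda>n. b n * w ^ n) sums f w" if "w \<in> U" for w
    unfolding f_def using summ[OF that] by (rule summable_sums)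
  have hf: "h (Re w, Im w) = Re (f w)" if "w \<in> U" for w
    using h[OF that] sums_Re[OF f[OF that]] by (rule sums_unique2)
  have "f holomorphic_on U"
    unfolding holomorphic_on_open[OF \<open>open U\<close>] f_def using conv termdiffs_strong by blast
  \<comment> \<open>The third integrand is \<open>2 * G\<close>, which must be the derivative of
    \<open>f\<close>.\<close>
  define G where "G = (\<lambda>w. deriv f w / 2)"
  define \<Phi> where "\<Phi> = (\<lambda>w. vector [w, - \<i> * w, f w] :: complex^3)"
  have prim: "weierstrass_primitive U (\<lambda>_. 1) G \<Phi>"
    unfolding weierstrass_primitive_def forall_3 vector_3 \<Phi>_def G_def
    using \<open>f holomorphic_on U\<close> \<open>open U\<close>
    by (auto intro!: holomorphic_intros holomorphic_deriv derivative_eq_intros holomorphic_derivI)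
  \<comment> \<open>In the third component \<open>l\<close> cancels; in the first two,
    \<open>Re (- \<i> * z) = Im z\<close> recovers the coordinates of
    \<open>A_C \<theta> l w\<close>.\<close>
  have bonnet: "bonnet_lopez_ros \<theta> l \<Phi> w =
      vector [Re (cis \<theta> * w / of_real l), Im (cis \<theta> * w / of_real l), Re (cis \<theta> * f w)]"
    if "l > 0" for \<theta> l w
    using that unfolding bonnet_lopez_ros_def exp_i_eq_cis
    by (simp add: Re_vec_def \<Phi>_def vec_eq_iff forall_3 diff_divide_distrib add_divide_distrib)
  show "\<exists>G \<Phi>. weierstrass_primitive (param_domain \<Omega>) (\<lambda>_. 1) G \<Phi> \<and>
        (\<forall>w\<in>param_domain \<Omega>. graph_param h w = Re_vec (\<Phi> w)) \<and>
        (\<forall>w\<in>param_domain \<Omega>. \<Phi> w $ 1 = w \<and> \<Phi> w $ 2 = - \<i> * w \<and>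
           (\<lambda>n. 2 * c n * w ^ n) sums (\<Phi> w $ 3)) \<and>
        (\<forall>\<theta>\<in>{0<..2*pi}. \<forall>l::real. l > 0 \<longrightarrow>
          weierstrass_surface (param_domain \<Omega>) (\<lambda>_. exp (\<i> * of_real \<theta>) / of_real l)
            (\<lambda>w. of_real l * G w) (bonnet_lopez_ros \<theta> l \<Phi>) \<and>
          (\<forall>Y. weierstrass_surface (param_domain \<Omega>) (\<lambda>_. exp (\<i> * of_real \<theta>) / of_real l)
                 (\<lambda>w. of_real l * G w) Y \<longrightarrow>
               (\<exists>t. \<forall>w\<in>param_domain \<Omega>. Y w = bonnet_lopez_ros \<theta> l \<Phi> w + t)) \<and>
          isotropic_minimal_surface (param_domain \<Omega>) (bonnet_lopez_ros \<theta> l \<Phi>) \<and>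
          (\<exists>h'. bonnet_lopez_ros \<theta> l \<Phi> ` param_domain \<Omega>
                  = graph_over (A_C \<theta> l ` param_domain \<Omega>) h' \<and>
            (\<forall>p\<in>A_C \<theta> l ` param_domain \<Omega>.
              summable (\<lambda>n. cos \<theta> * h_dil_Enpr c \<theta> l (n + 2) p) \<and>
              summable (\<lambda>n. sin \<theta> * h_conj_dil_Enpr c \<theta> l (n + 2) p) \<and>
              h' p = 4 * plane0 c \<theta> p + 4 * plane1 c \<theta> l p
                   + 2 * (\<Sum>n. cos \<theta> * h_dil_Enpr c \<theta> l (n + 2) p)
                   + 2 * (\<Sum>n. sin \<theta> * h_conj_dil_Enpr c \<theta> l (n + 2) p))) \<and>
          is_plane (graph_over UNIV (plane0 c \<theta>)) \<and>
          affine_parallel (graph_over UNIV (plane0 c \<theta>)) {v. v $ 3 = 0} \<and>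
          is_plane (graph_over UNIV (plane1 c \<theta> l)) \<and>
          (\<forall>p. plane1 c \<theta> l p = Re (c 1 * inv (A_C \<theta> l) p * exp (\<i> * of_real \<theta>) / 2)) \<and>
          (\<forall>n\<ge>2.
            isotropic_generalised_Enneper n (graph_param (\<lambda>(x, y). h_Enpr (c n) n (Complex x y))) \<and>
            dilated_rotated (graph_over UNIV (\<lambda>(x, y). h_Enpr (c n) n (Complex x y)))
              (graph_over UNIV (h_dil_Enpr c \<theta> l n)) \<and>
            (\<exists>Z. conjugate_surface UNIV (graph_param (\<lambda>(x, y). h_Enpr (c n) n (Complex x y))) Z \<and>
                 dilated_rotated (range Z) (graph_over UNIV (h_conj_dil_Enpr c \<theta> l n))) \<and>
            isotropic_generalised_Enneper n (graph_param (h_dil_Enpr c \<theta> l n)) \<and>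
            isotropic_generalised_Enneper n (graph_param (h_conj_dil_Enpr c \<theta> l n))))"
    unfolding U_def[symmetric]
  proof (rule exI[of _ G], rule exI[of _ \<Phi>], intro conjI ballI allI impI)
    show "weierstrass_primitive U (\<lambda>_. 1) G \<Phi>" by (rule prim)
  next
    fix w assume w: "w \<in> U"
    show "graph_param h w = Re_vec (\<Phi> w)"
      unfolding \<Phi>_def by (rule graph_param_eq_Re_vec) (rule hf[OF w])
    show "\<Phi> w $ 1 = w" "\<Phi> w $ 2 = - \<i> * w" "(\<lambda>n. 2 * c n * w ^ n) sums (\<Phi> w $ 3)"
      using f[OF w] by (simp_all add: \<Phi>_def b_def)
  next
    fix \<theta> l :: real assume "l > 0"
    then have "l \<noteq> 0" by simp
    let ?X = "bonnet_lopez_ros \<theta> l \<Phi>"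
    show X: "weierstrass_surface U (\<lambda>_. exp (\<i> * of_real \<theta>) / of_real l) (\<lambda>w. of_real l * G w) ?X"
      using prim \<open>l \<noteq> 0\<close> by (rule weierstrass_surface_bonnet_lopez_ros)
    show "\<exists>t. \<forall>w\<in>U. Y w = ?X w + t"
      if "weierstrass_surface U (\<lambda>_. exp (\<i> * of_real \<theta>) / of_real l) (\<lambda>w. of_real l * G w) Y" for Y
      using \<open>open U\<close> \<open>connected U\<close> X that by (rule weierstrass_surface_unique_up_to_translation)
    show "isotropic_minimal_surface U ?X"
      using \<open>open U\<close> X by (rule isotropic_minimal_weierstrass_surface) (simp add: \<open>l \<noteq> 0\<close>)
    have inv: "inv (A_C \<theta> l) (A_C \<theta> l w) = w" for w
      using inv_A_C(1)[OF \<open>l \<noteq> 0\<close>] by (simp add: bij_is_inj)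
    show "\<exists>h'. ?X ` U = graph_over (A_C \<theta> l ` U) h' \<and>
            (\<forall>p\<in>A_C \<theta> l ` U.
              summable (\<lambda>n. cos \<theta> * h_dil_Enpr c \<theta> l (n + 2) p) \<and>
              summable (\<lambda>n. sin \<theta> * h_conj_dil_Enpr c \<theta> l (n + 2) p) \<and>
              h' p = 4 * plane0 c \<theta> p + 4 * plane1 c \<theta> l p
                   + 2 * (\<Sum>n. cos \<theta> * h_dil_Enpr c \<theta> l (n + 2) p)
                   + 2 * (\<Sum>n. sin \<theta> * h_conj_dil_Enpr c \<theta> l (n + 2) p))"
    \<comment> \<open>The deformed surface lies over \<open>A_C \<theta> l w\<close> at height
      \<open>Re (cis \<theta> * f w)\<close>; the injectivity of \<open>A_C\<close> makes this a
      function of the base point.\<close>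
    proof (intro exI[of _ "\<lambda>p. Re (cis \<theta> * f (inv (A_C \<theta> l) p))"] conjI ballI)
      show "?X ` U = graph_over (A_C \<theta> l ` U) (\<lambda>p. Re (cis \<theta> * f (inv (A_C \<theta> l) p)))"
        unfolding graph_over_A_C inv using bonnet[OF \<open>l > 0\<close>] by (rule image_cong[OF refl])
      fix p assume "p \<in> A_C \<theta> l ` U"
      then have z: "inv (A_C \<theta> l) p \<in> U" using inv by auto
      have "summable (\<lambda>n. c n * inv (A_C \<theta> l) p ^ n)"
        using summable_mult[OF summ[OF z], of "1 / 2"] by (simp add: b_def)
      note decomp = deformed_height_decomposition[OF refl f[OF z, unfolded b_def] this]
      show "summable (\<lambda>n. cos \<theta> * h_dil_Enpr c \<theta> l (n + 2) p)"
        "summable (\<lambda>n. sin \<theta> * h_conj_dil_Enpr c \<theta> l (n + 2) p)"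
        "Re (cis \<theta> * f (inv (A_C \<theta> l) p)) = 4 * plane0 c \<theta> p + 4 * plane1 c \<theta> l p
          + 2 * (\<Sum>n. cos \<theta> * h_dil_Enpr c \<theta> l (n + 2) p)
          + 2 * (\<Sum>n. sin \<theta> * h_conj_dil_Enpr c \<theta> l (n + 2) p)"
        by (fact decomp)+
    qed
  next
    fix \<theta> l :: real assume "l > 0"
    then have "l \<noteq> 0" by simp
    show "is_plane (graph_over UNIV (plane0 c \<theta>))" by (rule is_plane_plane0)
    show "affine_parallel (graph_over UNIV (plane0 c \<theta>)) {v. v $ 3 = 0}" by (rule plane0_parallel)
    show "is_plane (graph_over UNIV (plane1 c \<theta> l))" using \<open>l \<noteq> 0\<close> by (rule is_plane_plane1)
    show "plane1 c \<theta> l p = Re (c 1 * inv (A_C \<theta> l) p * exp (\<i> * of_real \<theta>) / 2)" for p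
      by (rule plane1_eq)
    fix n :: nat assume "n \<ge> 2"
    then have "n > 0" by simp
    show "isotropic_generalised_Enneper n (graph_param (\<lambda>(x, y). h_Enpr (c n) n (Complex x y)))"
      using \<open>n > 0\<close> by (rule isotropic_generalised_Enneper_graph) (simp only: prod.case h_Enpr_eq)
    show "dilated_rotated (graph_over UNIV (\<lambda>(x, y). h_Enpr (c n) n (Complex x y)))
        (graph_over UNIV (h_dil_Enpr c \<theta> l n))"
      using \<open>l > 0\<close> by (rule dilated_rotated_h_dil_Enpr)
    show "\<exists>Z. conjugate_surface UNIV (graph_param (\<lambda>(x, y). h_Enpr (c n) n (Complex x y))) Z \<and>
        dilated_rotated (range Z) (graph_over UNIV (h_conj_dil_Enpr c \<theta> l n))"
      using \<open>n > 0\<close> \<open>l > 0\<close> by (rule conjugate_Enneper)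
    show "isotropic_generalised_Enneper n (graph_param (h_dil_Enpr c \<theta> l n))"
      "isotropic_generalised_Enneper n (graph_param (h_conj_dil_Enpr c \<theta> l n))"
      using \<open>n > 0\<close> \<open>l \<noteq> 0\<close> by (rule isotropic_generalised_Enneper_dil)+
  qed
qed

end
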